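(* Let $m\ge 1$ and let $G$ be a graph on $n$ vertices, $m$ of which are universal. Let $w_m$ be the smallest positive real root of $f_m(x)=x^{m+1}-x^m-2x+1$. Then $d_i(G)\ge d_{i+1}(G)$ for all $i \ge (1-w_m)n$.
   Context: $G$ is a finite simple graph. A vertex is universal if it is adjacent to every other vertex (degree $n-1$). A set $U\subseteq V(G)$ is dominating if every vertex is in $U$ or adjacent to a vertex of $U$; $d_i(G)$ is the number of dominating sets of $G$ of size $i$ (so $d_i(G)=0$ for $i>n$). *)

theory Defs
  imports Complex_Main "Graph_Theory.Pair_Digraph"
begin

text \<open>
  A finite simple graph is a \<^locale>\<open>pair_graph\<close>: a finite vertex set and a symmetric,
  irreflexive set of arcs (ordered pairs of vertices). Each undirected edge is represented by
  its two orientations, so \<open>u\<close> and \<open>v\<close> are adjacent iff \<open>(u, v) \<in> parcs G\<close>.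
\<close>

definition universal_vertex :: "'a pair_pre_digraph \<Rightarrow> 'a \<Rightarrow> bool" where
  "universal_vertex G v \<longleftrightarrow> v \<in> pverts G \<and> (\<forall>u \<in> pverts G. u \<noteq> v \<longrightarrow> (v, u) \<in> parcs G)"

definition dominating_set :: "'a pair_pre_digraph \<Rightarrow> 'a set \<Rightarrow> bool" where
  "dominating_set G U \<longleftrightarrow>
     U \<subseteq> pverts G \<and> (\<forall>v \<in> pverts G. v \<in> U \<or> (\<exists>u \<in> U. (v, u) \<in> parcs G))"

definition num_dominating_sets :: "'a pair_pre_digraph \<Rightarrow> nat \<Rightarrow> nat" where
  "num_dominating_sets G i = card {U. dominating_set G U \<and> card U = i}"

definition threshold_fun :: "nat \<Rightarrow> real \<Rightarrow> real" where
  "threshold_fun m x = x ^ (m + 1) - x ^ m - 2 * x + 1"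

definition threshold_root :: "nat \<Rightarrow> real" where
  "threshold_root m = (LEAST x. 0 < x \<and> threshold_fun m x = 0)"

text \<open>For \<open>m \<ge> 1\<close> the smallest positive root exists, so the \<open>LEAST\<close> above is meaningful.\<close>

lemma threshold_root_least:
  assumes "m \<ge> 1"
  shows "0 < threshold_root m" "threshold_fun m (threshold_root m) = 0"
    and "\<And>y. 0 < y \<Longrightarrow> threshold_fun m y = 0 \<Longrightarrow> threshold_root m \<le> y"
proof -
  have cont: "continuous_on A (threshold_fun m)" for A
    unfolding threshold_fun_def by (intro continuous_intros)
  have f0: "threshold_fun m 0 = 1" and f1: "threshold_fun m 1 = - 1"
    using assms by (simp_all add: threshold_fun_def)
  define S where "S = {0..1} \<inter> threshold_fun m -` {0}"
  have "compact S"
    unfolding S_def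
    by (metis cont closed_singleton closed_atLeastAtMost compact_Int_closed compact_Icc
        closed_vimage continuous_on_eq_continuous_at Int_commute)
  moreover have "\<exists>x. 0 \<le> x \<and> x \<le> 1 \<and> threshold_fun m x = 0"
    using IVT2'[of "threshold_fun m" 1 0 0] f0 f1 cont by auto
  hence "S \<noteq> {}" by (auto simp: S_def)
  ultimately obtain w where w: "w \<in> S" "\<And>y. y \<in> S \<Longrightarrow> w \<le> y"
    using compact_attains_inf by metis
  have w0: "0 < w \<and> threshold_fun m w = 0"
    using w(1) f0 by (cases "w = 0") (auto simp: S_def)
  have least: "w \<le> y" if "0 < y \<and> threshold_fun m y = 0" for y
  proof (cases "y \<le> 1")
    case True
    thus ?thesis using that w(2) by (simp add: S_def)
  next
    case False
    thus ?thesis using w(1) by (simp add: S_def)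
  qed
  have eq: "threshold_root m = w"
    unfolding threshold_root_def using w0 least by (intro Least_equality) auto
  show "0 < threshold_root m" "threshold_fun m (threshold_root m) = 0"
    using w0 by (simp_all add: eq)
  show "\<And>y. 0 < y \<Longrightarrow> threshold_fun m y = 0 \<Longrightarrow> threshold_root m \<le> y"
    using least by (simp add: eq)
qed

end

(* Every set containing a universal vertex dominates, so d_i(G) >= C(n,i) - C(n-m,i), while
   trivially d_(i+1)(G) <= C(n,i+1). With x = (n-i)/n one has C(n-m,i) <= x^m C(n,i) and
   (1-x) C(n,i+1) <= x C(n,i), so the claim holds as soon as (1 - x^m)(1 - x) >= x, that is
   f_m(x) >= 0. Since f_m(0) = 1, this is the case on [0, w_m]. *)
theory Submission
  imports Defs
begin

text \<open>The ratio of the two binomials is a product of \<open>m\<close> factors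
  \<open>(n - j - i) / (n - j)\<close> with \<open>j < m\<close>, each at most
  \<open>(n - i) / n\<close>. Denominators are cleared so that the induction stays in
  \<open>nat\<close>.\<close>

lemma binomial_diff_le:
  fixes n m i :: nat
  assumes "m \<le> n"
  shows "((n - m) choose i) * n ^ m \<le> (n choose i) * (n - i) ^ m"
  using assms
proof (induction m)
  case 0
  then show ?case by simp
next
  case (Suc m)
  define k where "k = n - m"
  have k: "0 < k" "n - Suc m = k - 1" "k \<le> n" using Suc.prems by (auto simp: k_def)
  have absorb: "(k - i) * (k choose i) = k * ((k - 1) choose i)"
    by (rule binomial_absorb_comp)
  have IH: "(k choose i) * n ^ m \<le> (n choose i) * (n - i) ^ m"
    using Suc by (simp add: k_def)
  have step: "n * (k - i) \<le> k * (n - i)"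
  proof -
    have "k * i \<le> n * i" using k by simp
    then show ?thesis by (simp add: diff_mult_distrib2 mult.commute diff_le_mono2)
  qed
  \<comment> \<open>The extra factor \<open>k\<close> lets \<open>absorb\<close> lower the top index
    without division; it is positive and cancels at the end.\<close>
  have "k * (((k - 1) choose i) * n ^ Suc m) = (n * (k - i)) * ((k choose i) * n ^ m)"
    using absorb by (simp add: mult_ac)
  also have "\<dots> \<le> (k * (n - i)) * ((n choose i) * (n - i) ^ m)"
    by (rule mult_mono[OF step IH]) auto
  also have "\<dots> = k * ((n choose i) * (n - i) ^ Suc m)" by (simp add: mult_ac)
  finally show ?case using k by simp
qed

text \<open>The sign change between 0 and 1 forces a root strictly inside. Strictness later allows
  cancelling the factor \<open>1 - y\<close>.\<close>

lemma threshold_root_less_1: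
  assumes "m \<ge> 1"
  shows "threshold_root m < 1"
proof -
  have "continuous_on {0..1} (threshold_fun m)"
    unfolding threshold_fun_def by (intro continuous_intros)
  moreover have "threshold_fun m 0 = 1" and f1: "threshold_fun m 1 = - 1"
    using assms by (simp_all add: threshold_fun_def)
  ultimately obtain x where x: "0 \<le> x" "x \<le> 1" "threshold_fun m x = 0"
    using IVT2'[of "threshold_fun m" 1 0 0] by auto
  have "x \<noteq> 0" "x \<noteq> 1" using x(3) \<open>threshold_fun m 0 = 1\<close> f1 by auto
  with x threshold_root_least(3)[OF assms, of x] show ?thesis by simp
qed

text \<open>Since the value at 0 is 1, a negative value at \<open>y\<close> would force a root in
  \<open>(0, y]\<close>; minimality of \<open>threshold_root m\<close> makes that root equal to
  \<open>y\<close>, a contradiction.\<close>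

lemma threshold_fun_nonneg:
  assumes "m \<ge> 1" "0 \<le> y" "y \<le> threshold_root m"
  shows "threshold_fun m y \<ge> 0"
proof (rule ccontr)
  assume neg: "\<not> threshold_fun m y \<ge> 0"
  have "continuous_on {0..y} (threshold_fun m)"
    unfolding threshold_fun_def by (intro continuous_intros)
  moreover have f0: "threshold_fun m 0 = 1"
    using assms by (simp add: threshold_fun_def)
  ultimately obtain x where x: "0 \<le> x" "x \<le> y" "threshold_fun m x = 0"
    using IVT2'[of "threshold_fun m" y 0 0] neg assms by auto
  have "x \<noteq> 0" using x(3) f0 by auto
  then have "threshold_root m \<le> x"
    using threshold_root_least(3)[OF assms(1), of x] x by simp
  then have "x = y" using x assms by simp
  with neg x show False by simp
qed

lemma num_dominating_sets_le_choose:
  assumes "finite (pverts G)"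
  shows "num_dominating_sets G i \<le> card (pverts G) choose i"
  unfolding num_dominating_sets_def n_subsets[OF assms, symmetric]
  by (rule card_mono) (use assms in \<open>auto simp: dominating_set_def\<close>)

lemma dominating_set_universal:
  assumes "pair_graph G" "U \<subseteq> pverts G" "u \<in> U" "universal_vertex G u"
  shows "dominating_set G U"
proof -
  interpret pair_graph G by fact
  have "v \<in> U \<or> (\<exists>w\<in>U. (v, w) \<in> parcs G)" if "v \<in> pverts G" for v
  proof (cases "v = u")
    case False
    then have "(u, v) \<in> parcs G" using assms(4) that by (simp add: universal_vertex_def)
    \<comment> \<open>Universality gives the arc leaving \<open>u\<close>, while domination asks for
      the arc entering it.\<close>
    then show ?thesis using assms(3) arcs_symmetric by metis
  qed (use assms(3) in simp)
  then show ?thesis using assms(2) by (simp add: dominating_set_def)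
qed

text \<open>A set of size \<open>i\<close> that does not dominate avoids \<open>W\<close> entirely,
  so it is one of the subsets of \<open>V - W\<close>. The additive form avoids truncated
  subtraction.\<close>

lemma choose_le_num_dominating_sets:
  assumes G: "pair_graph G"
  defines "V \<equiv> pverts G" and "W \<equiv> {v. universal_vertex G v}"
  shows "card V choose i \<le> num_dominating_sets G i + ((card V - card W) choose i)"
proof -
  interpret pair_graph G by fact
  have fin: "finite V"
    unfolding V_def by (rule pair_finite_verts)
  have WV: "W \<subseteq> V" by (auto simp: W_def V_def universal_vertex_def)
  have fW: "finite W" using fin WV by (rule rev_finite_subset)
  define D where "D = {U. dominating_set G U \<and> card U = i}"
  have "{U. U \<subseteq> V \<and> card U = i} \<subseteq> D \<union> {U. U \<subseteq> V - W \<and> card U = i}"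
    using dominating_set_universal[OF G] by (auto simp: D_def V_def W_def)
  moreover have "finite D"
    by (rule finite_subset[of _ "Pow V"]) (use fin in \<open>auto simp: D_def V_def dominating_set_def\<close>)
  moreover have "finite {U. U \<subseteq> V - W \<and> card U = i}" using fin by simp
  ultimately have "card {U. U \<subseteq> V \<and> card U = i} \<le> card D + card {U. U \<subseteq> V - W \<and> card U = i}"
    by (meson card_Un_le card_mono finite_UnI le_trans)
  then show ?thesis
    using fin by (simp add: n_subsets card_Diff_subset[OF fW WV] D_def num_dominating_sets_def)
qed

theorem theorem7p2:
  fixes G :: "'a pair_pre_digraph" and m n :: nat
  assumes "pair_graph G"
    and "n = card (pverts G)"
    and "m \<ge> 1"
    and "card {v. universal_vertex G v} = m"
  shows "\<forall>i::nat. real i \<ge> (1 - threshold_root m) * real n \<longrightarrow>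
           num_dominating_sets G i \<ge> num_dominating_sets G (i + 1)"
proof (intro allI impI)
  fix i :: nat
  assume i: "real i \<ge> (1 - threshold_root m) * real n"
  interpret pair_graph G by fact
  have fin: "finite (pverts G)" by (rule pair_finite_verts)
  have "{v. universal_vertex G v} \<subseteq> pverts G" by (auto simp: universal_vertex_def)
  then have mn: "m \<le> n" using assms(2,4) card_mono[OF fin] by metis
  then have n0: "n > 0" using assms(3) by simp
  have upper: "num_dominating_sets G (i + 1) \<le> n choose (i + 1)"
    using num_dominating_sets_le_choose[OF fin] assms(2) by simp
  show "num_dominating_sets G i \<ge> num_dominating_sets G (i + 1)"
  proof (cases "i \<le> n")
    case False
    then have "n choose (i + 1) = 0" by (intro binomial_eq_0) simp
    then show ?thesis using upper by linarith
  next
    case True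
    \<comment> \<open>In terms of \<open>y\<close>, the hypothesis on \<open>i\<close> reads
      \<open>y \<le> threshold_root m\<close>.\<close>
    define y where "y = real (n - i) / real n"
    have ny: "real n * y = real n - real i" using n0 True by (simp add: y_def)
    have "real n * y \<le> real n * threshold_root m" using i ny by (simp add: algebra_simps)
    then have yw: "y \<le> threshold_root m" using n0 by simp
    have y0: "0 \<le> y" by (simp add: y_def)
    have y1: "y < 1" using yw threshold_root_less_1[OF assms(3)] by simp
    \<comment> \<open>The difference of the two sides is exactly
      \<open>threshold_fun m y\<close>.\<close>
    have f: "y \<le> (1 - y ^ m) * (1 - y)"
      using threshold_fun_nonneg[OF assms(3) y0 yw]
      by (simp add: threshold_fun_def algebra_simps)
    define B where "B = real (n choose i)"
    define B' where "B' = real (n choose (i + 1))"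
    define C where "C = real ((n - m) choose i)"
    have C: "C \<le> B * y ^ m"
    proof -
      have "C * real n ^ m \<le> B * real (n - i) ^ m"
        using binomial_diff_le[OF mn, of i] unfolding B_def C_def
        by (metis of_nat_le_iff of_nat_mult of_nat_power)
      then show ?thesis using n0 by (simp add: y_def power_divide field_simps)
    qed
    have B': "B' * (1 - y) \<le> B * y"
    proof -
      \<comment> \<open>Both sides equal \<open>n * ((n - 1) choose i)\<close>.\<close>
      have "(i + 1) * (n choose (i + 1)) = (n - i) * (n choose i)"
        using binomial_absorption[of i n] binomial_absorb_comp[of n i] by simp
      then have "(real i + 1) * B' = real (n - i) * B"
        unfolding B_def B'_def by (metis of_nat_mult of_nat_1 of_nat_add)
      moreover have "B' \<ge> 0" by (simp add: B'_def)
      \<comment> \<open>Weakening \<open>i + 1\<close> to \<open>i\<close> loses little and turns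
        the coefficients into \<open>n * (1 - y)\<close> and \<open>n * y\<close>.\<close>
      ultimately have "real i * B' \<le> real (n - i) * B" by (simp add: algebra_simps)
      moreover have "real i = real n * (1 - y)" "real (n - i) = real n * y"
        using ny True by (simp_all add: algebra_simps)
      ultimately have "real n * (B' * (1 - y)) \<le> real n * (B * y)"
        by (simp only: mult_ac)
      then show ?thesis using n0 by simp
    qed
    have "B' * (1 - y) \<le> B * ((1 - y ^ m) * (1 - y))"
      using B' mult_left_mono[OF f, of B] by (simp add: B_def)
    also have "\<dots> = (B - B * y ^ m) * (1 - y)" by (simp add: algebra_simps)
    finally have "B' \<le> B - B * y ^ m" using y1 by simp
    then have "B' + C \<le> B" using C by simp
    then have "(n choose (i + 1)) + ((n - m) choose i) \<le> n choose i"
      by (simp add: B_def B'_def C_def flip: of_nat_add)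
    \<comment> \<open>The term \<open>(n - m) choose i\<close> also bounds the non-dominating sets
      of size \<open>i\<close>, so it cancels between the two estimates.\<close>
    with upper choose_le_num_dominating_sets[OF assms(1), of i] show ?thesis
      by (simp add: assms(2,4))
  qed
qed

end
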